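(* Consider the problem $$(SP)\qquad \text{minimize}\quad Ef(x,\bar u)\quad\text{over }x\in\mathcal N$$ and the dual problem $$(D)\qquad \text{maximize}\quad \langle\bar u,y\rangle-Ef^*(p,y)\quad\text{over }(p,y)\in\mathcal X_a^\perp\times\mathcal Y.$$ If $\operatorname{dom}Ef\cap(\mathcal X\times\mathcal U)\neq\emptyset$ (i.e. $Ef(x,u)<\infty$ for some $(x,u)\in\mathcal X\times\mathcal U$) and $(SP)$ and $(D)$ are feasible, then the following are equivalent: 1. $x$ solves $(SP)$, $(p,y)$ solves $(D)$ and $\inf(SP)=\sup(D)$; 2. $x$ is feasible in $(SP)$, $(p,y)$ is feasible in $(D)$ and $(p,y)\in\partial f(x,\bar u)$ $P$-a.s.; 3. $x$ is feasible in $(SP)$, $(p,y)$ is feasible in $(D)$ and $$p\in\partial_xl(x,y),\qquad \bar u\in\partial_y[-l](x,y)\qquad P\text{-a.s.}$$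
   Context: $(\Omega,\mathcal F,P)$ is a probability space with a filtration $(\mathcal F_t)_{t=0}^T$ (an increasing sequence of sub-$\sigma$-algebras of $\mathcal F$). $n=n_0+\dots+n_T$ and $\mathcal N$ is the linear space of all $x=(x_t)_{t=0}^T\in L^0(\mathbb R^n)$ such that $x_t$ is $\mathbb R^{n_t}$-valued and $\mathcal F_t$-measurable for every $t$. Random variables equal a.s. are identified. Convention: the expectation of an extended real-valued random variable is $+\infty$ unless its positive part is integrable. $f$ is a convex normal integrand on $\mathbb R^n\times\mathbb R^m\times\Omega$: $f(\cdot,\omega)$ is a closed convex extended real-valued function for every $\omega$ (closed: lower semicontinuous and either proper or identically $+\infty$ or identically $-\infty$) and $\omega\mapsto\operatorname{epi}f(\cdot,\omega)$ is a measurable set-valued mapping. $Ef(x,u):=\int f(x(\omega),u(\omega),\omega)\,dP(\omega)$; $f^*(v,y,\omega):=\sup_{x,u}\{x\cdot v+u\cdot y-f(x,u,\omega)\}$ and $Ef^*$ is the corresponding integral functional. The Lagrangian integrand is $l(x,y,\omega):=\inf_{u\in\mathbb R^m}\{f(x,u,\omega)-u\cdot y\}$. Subdifferentials are taken $\omega$-wise: $\partial f$ of $f(\cdot,\cdot,\omega)$, $\partial_xl$ of the convex function $l(\cdot,y,\omega)$, $\partial_y[-l]$ of the convex function $-l(x,\cdot,\omega)$; a subdifferential is empty at points where the function is not finite. A linear space $\mathcal U$ of $\mathbb R^m$-valued random variables is decomposable if $1_Au+1_{\Omega\setminus A}u'\in\mathcal U$ for all $u\in\mathcal U$, $u'\in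 L^\infty$, $A\in\mathcal F$; it is solid if $\bar u\in\mathcal U$, $u\in L^0$ and $|u^i|\le|\bar u^i|$ a.s. for all components $i$ imply $u\in\mathcal U$. $\mathcal X,\mathcal V$ are solid decomposable spaces of $\mathbb R^n$-valued random variables in separating duality under $\langle x,v\rangle:=E[x\cdot v]$ and $\mathcal U,\mathcal Y$ are solid decomposable spaces of $\mathbb R^m$-valued random variables in separating duality under $\langle u,y\rangle:=E[u\cdot y]$ (in particular the products are integrable). $\bar u\in\mathcal U$ is fixed. $\mathcal X_a:=\mathcal X\cap\mathcal N$ and $\mathcal X_a^\perp:=\{v\in\mathcal V: \langle x,v\rangle=0\ \forall x\in\mathcal X_a\}$. $x$ is feasible in $(SP)$ if $x\in\mathcal N$ and $Ef(x,\bar u)<\infty$; $(p,y)$ is feasible in $(D)$ if $(p,y)\in\mathcal X_a^\perp\times\mathcal Y$ and $Ef^*(p,y)<\infty$; a problem is feasible if it has a feasible point. "Solves" means feasible and attaining the optimum value. *)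

theory Defs
  imports "HOL-Probability.Probability"
begin

text \<open>
  Elements of \<open>L\<^sup>0\<close> are represented by measurable functions. A space of random variables is a set of
  such functions; for solid spaces membership depends only on the almost sure equivalence class.
\<close>

section \<open>Extended real-valued convex functions\<close>

definition epi :: "('a \<Rightarrow> ereal) \<Rightarrow> ('a \<times> real) set" where
  "epi g = {(z, \<alpha>). g z \<le> ereal \<alpha>}"

text \<open>Convexity through the epigraph avoids sums such as \<open>\<infinity> + (-\<infinity>)\<close>.\<close>

definition ext_convex :: "('a::real_vector \<Rightarrow> ereal) \<Rightarrow> bool" where
  "ext_convex g \<longleftrightarrow> convex (epi g)"

definition lower_semicont :: "('a::topological_space \<Rightarrow> ereal) \<Rightarrow> bool" where
  "lower_semicont g \<longleftrightarrow> (\<forall>z. g z \<le> Liminf (at z) g)"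

definition proper_fun :: "('a \<Rightarrow> ereal) \<Rightarrow> bool" where
  "proper_fun g \<longleftrightarrow> (\<forall>z. g z \<noteq> -\<infinity>) \<and> (\<exists>z. g z \<noteq> \<infinity>)"

definition closed_fun :: "('a::topological_space \<Rightarrow> ereal) \<Rightarrow> bool" where
  "closed_fun g \<longleftrightarrow>
     lower_semicont g \<and> (proper_fun g \<or> (\<forall>z. g z = \<infinity>) \<or> (\<forall>z. g z = -\<infinity>))"

definition subdifferential :: "('a::real_inner \<Rightarrow> ereal) \<Rightarrow> 'a \<Rightarrow> 'a set" where
  "subdifferential g z =
     {v. \<bar>g z\<bar> \<noteq> \<infinity> \<and> (\<forall>z'. g z + ereal (v \<bullet> (z' - z)) \<le> g z')}"

section \<open>Integrands\<close>

definition measurable_mapping :: "'w measure \<Rightarrow> ('w \<Rightarrow> 'a::topological_space set) \<Rightarrow> bool" where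
  "measurable_mapping M S \<longleftrightarrow> (\<forall>G. open G \<longrightarrow> {\<omega> \<in> space M. S \<omega> \<inter> G \<noteq> {}} \<in> sets M)"

definition convex_normal_integrand ::
  "'w measure \<Rightarrow> ('a::real_normed_vector \<Rightarrow> 'w \<Rightarrow> ereal) \<Rightarrow> bool" where
  "convex_normal_integrand M f \<longleftrightarrow>
     (\<forall>\<omega>\<in>space M. ext_convex (\<lambda>z. f z \<omega>) \<and> closed_fun (\<lambda>z. f z \<omega>)) \<and>
     measurable_mapping M (\<lambda>\<omega>. epi (\<lambda>z. f z \<omega>))"

text \<open>
  The map \<open>e2ennreal\<close> truncates negative values to 0, so the two integrals below are those of the
  positive and the negative part. The value is \<open>\<infinity>\<close> unless the positive part is integrable.
\<close>

definition ext_expectation :: "'w measure \<Rightarrow> ('w \<Rightarrow> ereal) \<Rightarrow> ereal" where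
  "ext_expectation M \<xi> =
     (if (\<integral>\<^sup>+\<omega>. e2ennreal (\<xi> \<omega>) \<partial>M) = \<infinity> then \<infinity>
      else enn2ereal (\<integral>\<^sup>+\<omega>. e2ennreal (\<xi> \<omega>) \<partial>M) - enn2ereal (\<integral>\<^sup>+\<omega>. e2ennreal (- \<xi> \<omega>) \<partial>M))"

definition integral_functional ::
  "'w measure \<Rightarrow> ('a \<times> 'b \<Rightarrow> 'w \<Rightarrow> ereal) \<Rightarrow> ('w \<Rightarrow> 'a) \<Rightarrow> ('w \<Rightarrow> 'b) \<Rightarrow> ereal" where
  "integral_functional M f x u = ext_expectation M (\<lambda>\<omega>. f (x \<omega>, u \<omega>) \<omega>)"

definition conjugate ::
  "('a::real_inner \<times> 'b::real_inner \<Rightarrow> 'w \<Rightarrow> ereal) \<Rightarrow> 'a \<times> 'b \<Rightarrow> 'w \<Rightarrow> ereal" where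
  "conjugate f = (\<lambda>(v, y) \<omega>. SUP (x, u)\<in>UNIV. ereal (x \<bullet> v + u \<bullet> y) - f (x, u) \<omega>)"

definition lagrangian ::
  "('a \<times> 'b::real_inner \<Rightarrow> 'w \<Rightarrow> ereal) \<Rightarrow> 'a \<Rightarrow> 'b \<Rightarrow> 'w \<Rightarrow> ereal" where
  "lagrangian f x y \<omega> = (INF u. f (x, u) \<omega> - ereal (u \<bullet> y))"

section \<open>Spaces of random variables\<close>

definition rv_space :: "'w measure \<Rightarrow> ('w \<Rightarrow> 'a::euclidean_space) set \<Rightarrow> bool" where
  "rv_space M U \<longleftrightarrow>
     U \<subseteq> borel_measurable M \<and> (\<lambda>_. 0) \<in> U \<and>
     (\<forall>u\<in>U. \<forall>u'\<in>U. (\<lambda>\<omega>. u \<omega> + u' \<omega>) \<in> U) \<and>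
     (\<forall>c. \<forall>u\<in>U. (\<lambda>\<omega>. c *\<^sub>R u \<omega>) \<in> U)"

definition ess_bounded :: "'w measure \<Rightarrow> ('w \<Rightarrow> 'a::euclidean_space) set" where
  "ess_bounded M = {u \<in> borel_measurable M. \<exists>C. AE \<omega> in M. norm (u \<omega>) \<le> C}"

definition decomposable :: "'w measure \<Rightarrow> ('w \<Rightarrow> 'a::euclidean_space) set \<Rightarrow> bool" where
  "decomposable M U \<longleftrightarrow>
     (\<forall>u\<in>U. \<forall>u'\<in>ess_bounded M. \<forall>A\<in>sets M.
        (\<lambda>\<omega>. indicat_real A \<omega> *\<^sub>R u \<omega> + indicat_real (space M - A) \<omega> *\<^sub>R u' \<omega>) \<in> U)"

definition solid :: "'w measure \<Rightarrow> ('w \<Rightarrow> real ^ 'k) set \<Rightarrow> bool" where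
  "solid M U \<longleftrightarrow>
     (\<forall>u0\<in>U. \<forall>u\<in>borel_measurable M.
        (\<forall>i. AE \<omega> in M. \<bar>u \<omega> $ i\<bar> \<le> \<bar>u0 \<omega> $ i\<bar>) \<longrightarrow> u \<in> U)"

definition pairing ::
  "'w measure \<Rightarrow> ('w \<Rightarrow> 'a::euclidean_space) \<Rightarrow> ('w \<Rightarrow> 'a) \<Rightarrow> real" where
  "pairing M u y = (\<integral>\<omega>. u \<omega> \<bullet> y \<omega> \<partial>M)"

definition separating_duality ::
  "'w measure \<Rightarrow> ('w \<Rightarrow> 'a::euclidean_space) set \<Rightarrow> ('w \<Rightarrow> 'a) set \<Rightarrow> bool" where
  "separating_duality M U Y \<longleftrightarrow>
     (\<forall>u\<in>U. \<forall>y\<in>Y. integrable M (\<lambda>\<omega>. u \<omega> \<bullet> y \<omega>)) \<and>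
     (\<forall>u\<in>U. (\<forall>y\<in>Y. pairing M u y = 0) \<longrightarrow> (AE \<omega> in M. u \<omega> = 0)) \<and>
     (\<forall>y\<in>Y. (\<forall>u\<in>U. pairing M u y = 0) \<longrightarrow> (AE \<omega> in M. y \<omega> = 0))"

definition discrete_filtration :: "'w measure \<Rightarrow> nat \<Rightarrow> (nat \<Rightarrow> 'w measure) \<Rightarrow> bool" where
  "discrete_filtration M T F \<longleftrightarrow>
     (\<forall>t\<le>T. subalgebra M (F t)) \<and> (\<forall>s t. s \<le> t \<longrightarrow> t \<le> T \<longrightarrow> sets (F s) \<subseteq> sets (F t))"

text \<open>
  The decomposition \<open>n = n\<^sub>0 + \<dots> + n\<^sub>T\<close> is given by a map \<open>stage\<close> from coordinates to time indices:
  \<open>x\<^sub>t\<close> consists of the coordinates \<open>i\<close> with \<open>stage i = t\<close>, and \<open>n\<^sub>t\<close> is their number.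
  As the filtration need not contain the null sets, measurability of the equivalence class
  means that some representative is measurable.
\<close>

definition adapted_strategies ::
  "'w measure \<Rightarrow> (nat \<Rightarrow> 'w measure) \<Rightarrow> ('n \<Rightarrow> nat) \<Rightarrow> ('w \<Rightarrow> real ^ 'n) set" where
  "adapted_strategies M F stage =
     {x \<in> borel_measurable M.
        \<forall>i. \<exists>g \<in> borel_measurable (F (stage i)). AE \<omega> in M. x \<omega> $ i = g \<omega>}"

definition orth_complement ::
  "'w measure \<Rightarrow> ('w \<Rightarrow> 'a::euclidean_space) set \<Rightarrow> ('w \<Rightarrow> 'a) set \<Rightarrow> ('w \<Rightarrow> 'a) set" where
  "orth_complement M V Z = {v \<in> V. \<forall>x\<in>Z. pairing M x v = 0}"

section \<open>The primal and the dual problem\<close>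

text \<open>
  In the following \<open>N\<close> is the space of adapted strategies and \<open>P\<close> the orthogonal complement of
  its intersection with the space of primal variables.
\<close>

definition SP_feasible where
  "SP_feasible M f N ubar x \<longleftrightarrow> x \<in> N \<and> integral_functional M f x ubar < \<infinity>"

definition SP_value where
  "SP_value M f N ubar = (INF x\<in>N. integral_functional M f x ubar)"

definition SP_solves where
  "SP_solves M f N ubar x \<longleftrightarrow>
     SP_feasible M f N ubar x \<and> integral_functional M f x ubar = SP_value M f N ubar"

definition D_feasible where
  "D_feasible M f P Y p y \<longleftrightarrow>
     p \<in> P \<and> y \<in> Y \<and> integral_functional M (conjugate f) p y < \<infinity>"

definition D_objective where
  "D_objective M f ubar p y =
     ereal (pairing M ubar y) - integral_functional M (conjugate f) p y"

definition D_value where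
  "D_value M f P Y ubar = (SUP (p, y)\<in>P \<times> Y. D_objective M f ubar p y)"

definition D_solves where
  "D_solves M f P Y ubar p y \<longleftrightarrow>
     D_feasible M f P Y p y \<and> D_objective M f ubar p y = D_value M f P Y ubar"

end

theory Submission
  imports Defs
begin

text \<open>
  For feasible points Fenchel's inequality gives \<open>x \<bullet> p + ubar \<bullet> y \<le> f (x, ubar) + f\<^sup>* (p, y)\<close> almost
  surely, so the positive part of \<open>x \<bullet> p\<close> is integrable. Since \<open>x\<close> is adapted and \<open>p\<close> is orthogonal to the
  bounded adapted strategies, this already forces \<open>x \<bullet> p\<close> to be integrable with mean zero, although
  \<open>x\<close> need not belong to \<open>X\<close>. Hence the duality gap is the integral of the nonnegative slack in
  Fenchel's inequality, and it vanishes exactly when the slack does almost surely, which is the subgradient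
  condition. The Lagrangian form of that condition is the pointwise biconjugate theorem applied
  to \<open>f (x, \<cdot>)\<close> at \<open>ubar\<close>.
\<close>

section \<open>Measurability of normal integrands and of their conjugates\<close>

text \<open>Second countability makes \<open>R\<close> a countable union of basic boxes
  \<open>a \<times> b\<close>, and for one box the event splits into "\<open>S\<close> hits
  \<open>a\<close>" and "\<open>v\<close> lies in \<open>b\<close>". It serves for open relations
  between a point of a random epigraph and a random vector.\<close>

lemma measurable_mapping_hits_open:
  fixes S :: "'w \<Rightarrow> 'a::second_countable_topology set"
    and v :: "'w \<Rightarrow> 'b::second_countable_topology"
  assumes S: "measurable_mapping M S" and v: "v \<in> borel_measurable M" and R: "open R"
  shows "{\<omega> \<in> space M. \<exists>s\<in>S \<omega>. (s, v \<omega>) \<in> R} \<in> sets M"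
proof -
  obtain A :: "'a set set" where A: "countable A" "topological_basis A"
    using ex_countable_basis by auto
  obtain B :: "'b set set" where B: "countable B" "topological_basis B"
    using ex_countable_basis by auto
  define I where "I = {(a, b). a \<in> A \<and> b \<in> B \<and> a \<times> b \<subseteq> R}"
  have "I \<subseteq> A \<times> B"
    by (auto simp: I_def)
  then have "countable I"
    using A(1) B(1) countable_SIGMA countable_subset by metis
  have box: "\<exists>(a, b)\<in>I. s \<in> a \<and> t \<in> b" if st: "(s, t) \<in> R" for s t
  proof -
    obtain a' b' where ab': "open a'" "open b'" "s \<in> a'" "t \<in> b'" "a' \<times> b' \<subseteq> R"
      by (rule open_prod_elim[OF R st]) blast
    obtain a where a: "a \<in> A" "s \<in> a" "a \<subseteq> a'"
      using topological_basisE[OF A(2) ab'(1,3)] .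
    obtain b where b: "b \<in> B" "t \<in> b" "b \<subseteq> b'"
      using topological_basisE[OF B(2) ab'(2,4)] .
    have "a \<times> b \<subseteq> R"
      using a(3) b(3) ab'(5) by blast
    with a b show ?thesis
      unfolding I_def by auto
  qed
  have eq: "{\<omega> \<in> space M. \<exists>s\<in>S \<omega>. (s, v \<omega>) \<in> R} =
      (\<Union>(a, b)\<in>I. {\<omega> \<in> space M. S \<omega> \<inter> a \<noteq> {}} \<inter> (v -` b \<inter> space M))" (is "?L = ?R")
  proof
    show "?L \<subseteq> ?R"
    proof
      fix \<omega> assume \<omega>: "\<omega> \<in> ?L"
      then obtain s where s: "s \<in> S \<omega>" "(s, v \<omega>) \<in> R"
        by blast
      then obtain a b where "(a, b) \<in> I" "s \<in> a" "v \<omega> \<in> b"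
        using box by blast
      with \<omega> s(1) show "\<omega> \<in> ?R"
        by blast
    qed
    show "?R \<subseteq> ?L"
      by (auto simp: I_def)
  qed
  have "{\<omega> \<in> space M. S \<omega> \<inter> a \<noteq> {}} \<inter> (v -` b \<inter> space M) \<in> sets M"
    if "(a, b) \<in> I" for a b
  proof -
    have "open a" "open b"
      using that A(2) B(2) topological_basis_open by (auto simp: I_def)
    then show ?thesis
      using S v by (auto simp: measurable_mapping_def intro!: sets.Int measurable_sets[of v M borel])
  qed
  then show ?thesis
    unfolding eq using \<open>countable I\<close> by (auto intro!: sets.countable_UN')
qed

text \<open>If \<alpha> lies strictly below \<open>g z\<close>, a real \<beta> fits strictly between
  them, and lower semicontinuity keeps \<open>g\<close> above \<beta> near \<open>z\<close>; the
  part of that neighbourhood's cylinder below \<beta> then misses the epigraph.\<close>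

lemma closed_epi:
  fixes g :: "'a::topological_space \<Rightarrow> ereal"
  assumes "lower_semicont g"
  shows "closed (epi g)"
  unfolding closed_def
proof (subst open_subopen, safe)
  fix z \<alpha> assume "(z, \<alpha>) \<notin> epi g"
  then have "ereal \<alpha> < g z"
    by (simp add: epi_def)
  then obtain \<beta> where \<beta>: "ereal \<alpha> < ereal \<beta>" "ereal \<beta> < g z"
    using ereal_dense2 by blast
  then have "ereal \<beta> < Liminf (at z) g"
    using assms less_le_trans unfolding lower_semicont_def by blast
  then have "\<forall>\<^sub>F z' in at z. ereal \<beta> < g z'"
    by (rule less_LiminfD)
  then obtain W where W: "open W" "z \<in> W" "\<And>z'. z' \<in> W \<Longrightarrow> z' \<noteq> z \<Longrightarrow> ereal \<beta> < g z'"
    unfolding eventually_at_topological by blast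
  have "W \<times> {..<\<beta>} \<subseteq> - epi g"
  proof
    fix q assume "q \<in> W \<times> {..<\<beta>}"
    \<comment> \<open>The limit inferior runs along the punctured filter \<open>at z\<close>, so at
      \<open>z\<close> itself the bound comes from the choice of \<beta>.\<close>
    moreover have "ereal \<beta> < g (fst q)" if "fst q \<in> W"
      using that W(3) \<beta>(2) by (cases "fst q = z") auto
    ultimately have "ereal (snd q) < g (fst q)"
      by (auto intro: less_trans[of _ "ereal \<beta>"])
    then show "q \<in> - epi g"
      by (auto simp: epi_def not_le split: prod.splits)
  qed
  moreover have "open (W \<times> {..<\<beta>})" "(z, \<alpha>) \<in> W \<times> {..<\<beta>}"
    using W \<beta> by (auto intro: open_Times)
  ultimately show "\<exists>T. open T \<and> (z, \<alpha>) \<in> T \<and> T \<subseteq> - epi g"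
    by blast
qed

text \<open>A real level \<alpha> is reached exactly when \<open>(z \<omega>, \<alpha>)\<close>
  belongs to the closed epigraph, that is, when the epigraph meets every ball of radius
  \<open>1 / (n + 1)\<close> around this point. These are countably many open conditions.\<close>

lemma normal_integrand_measurable:
  fixes f :: "'a::euclidean_space \<Rightarrow> 'w \<Rightarrow> ereal"
  assumes f: "convex_normal_integrand M f" and z: "z \<in> borel_measurable M"
  shows "(\<lambda>\<omega>. f (z \<omega>) \<omega>) \<in> borel_measurable M"
proof -
  have le: "{\<omega> \<in> space M. f (z \<omega>) \<omega> \<le> ereal \<alpha>} \<in> sets M" for \<alpha>
  proof -
    let ?S = "\<lambda>\<omega>. epi (\<lambda>z. f z \<omega>)"
    define R :: "nat \<Rightarrow> (('a \<times> real) \<times> 'a) set"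
      where "R n = {(s, q). dist s (q, \<alpha>) < inverse (Suc n)}" for n :: nat
    have "open (R n)" for n
      unfolding R_def case_prod_unfold by (intro open_Collect_less continuous_intros)
    moreover have "measurable_mapping M ?S"
      using f by (simp add: convex_normal_integrand_def)
    ultimately have meas: "{\<omega> \<in> space M. \<exists>s\<in>?S \<omega>. (s, z \<omega>) \<in> R n} \<in> sets M" for n
      using z by (intro measurable_mapping_hits_open)
    have "f (z \<omega>) \<omega> \<le> ereal \<alpha> \<longleftrightarrow> (\<forall>n. \<exists>s\<in>?S \<omega>. (s, z \<omega>) \<in> R n)" if "\<omega> \<in> space M" for \<omega>
    proof -
      have cl: "closed (?S \<omega>)"
        using f that by (intro closed_epi) (auto simp: convex_normal_integrand_def closed_fun_def)
      have "f (z \<omega>) \<omega> \<le> ereal \<alpha> \<longleftrightarrow> (z \<omega>, \<alpha>) \<in> closure (?S \<omega>)"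
        using cl by (simp add: epi_def)
      also have "\<dots> \<longleftrightarrow> (\<forall>e>0. \<exists>s\<in>?S \<omega>. dist s (z \<omega>, \<alpha>) < e)"
        by (rule closure_approachable)
      also have "\<dots> \<longleftrightarrow> (\<forall>n. \<exists>s\<in>?S \<omega>. dist s (z \<omega>, \<alpha>) < inverse (Suc n))"
      proof (intro iffI allI impI)
        fix e :: real assume n: "\<forall>n. \<exists>s\<in>?S \<omega>. dist s (z \<omega>, \<alpha>) < inverse (Suc n)" and "e > 0"
        then obtain n where "inverse (Suc n) < e"
          using reals_Archimedean by blast
        with n show "\<exists>s\<in>?S \<omega>. dist s (z \<omega>, \<alpha>) < e"
          by (meson less_trans)
      qed auto
      finally show ?thesis
        by (simp add: R_def)
    qed
    then have "{\<omega> \<in> space M. f (z \<omega>) \<omega> \<le> ereal \<alpha>} =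
        {\<omega> \<in> space M. \<forall>n. \<exists>s\<in>?S \<omega>. (s, z \<omega>) \<in> R n}"
      by blast
    also have "\<dots> \<in> sets M"
      using meas by (rule sets.sets_Collect_countable_All)
    finally show ?thesis .
  qed
  show ?thesis
  proof (rule borel_measurableI_le)
    fix c :: ereal
    show "{\<omega> \<in> space M. f (z \<omega>) \<omega> \<le> c} \<in> sets M"
    proof (cases c)
      \<comment> \<open>The level -\<infinity> is the intersection of the real levels
        \<open>- n\<close>.\<close>
      case MInf
      have "f (z \<omega>) \<omega> \<le> c \<longleftrightarrow> (\<forall>n::nat. f (z \<omega>) \<omega> \<le> ereal (- real n))" for \<omega>
      proof
        assume n: "\<forall>n::nat. f (z \<omega>) \<omega> \<le> ereal (- real n)"
        have "f (z \<omega>) \<omega> \<le> ereal B" for B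
        proof -
          obtain n :: nat where "- B \<le> real n"
            using real_arch_simple by blast
          then show ?thesis
            using n[rule_format, of n] by (elim order_trans) simp
        qed
        then show "f (z \<omega>) \<omega> \<le> c"
          using MInf ereal_bot by force
      qed (simp add: MInf)
      then show ?thesis
        using le by (simp add: sets.sets_Collect_countable_All)
    qed (use le in auto)
  qed
qed

lemma conjugate_eq_SUP: "conjugate f v \<omega> = (SUP z. ereal (z \<bullet> v) - f z \<omega>)"
  by (cases v) (simp add: conjugate_def case_prod_unfold inner_prod_def)

lemma conjugate_eq_SUP_epi:
  "conjugate f v \<omega> = (SUP (z, \<alpha>)\<in>epi (\<lambda>z. f z \<omega>). ereal (z \<bullet> v - \<alpha>))"
proof (rule antisym)
  show "conjugate f v \<omega> \<le> (SUP (z, \<alpha>)\<in>epi (\<lambda>z. f z \<omega>). ereal (z \<bullet> v - \<alpha>))" (is "_ \<le> ?r")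
    unfolding conjugate_eq_SUP
  proof (rule SUP_least)
    fix z
    have le: "ereal (z \<bullet> v - \<alpha>) \<le> ?r" if "f z \<omega> \<le> ereal \<alpha>" for \<alpha>
      using that by (intro SUP_upper2[of "(z, \<alpha>)"]) (auto simp: epi_def)
    show "ereal (z \<bullet> v) - f z \<omega> \<le> ?r"
    proof (cases "f z \<omega>")
      case (real \<alpha>)
      then show ?thesis
        using le[of \<alpha>] by simp
    next
      \<comment> \<open>The epigraph contains the whole vertical line over \<open>z\<close>, so both
        sides are \<infinity>.\<close>
      case MInf
      have "ereal \<beta> \<le> ?r" for \<beta>
        using le[of "z \<bullet> v - \<beta>"] MInf by simp
      then have "?r = \<infinity>"
        using ereal_top by blast
      then show ?thesis
        by simp
    qed simp
  qed
  show "(SUP (z, \<alpha>)\<in>epi (\<lambda>z. f z \<omega>). ereal (z \<bullet> v - \<alpha>)) \<le> conjugate f v \<omega>"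
    unfolding conjugate_eq_SUP
  proof (safe intro!: SUP_least)
    fix z \<alpha> assume "(z, \<alpha>) \<in> epi (\<lambda>z. f z \<omega>)"
    then have "ereal (z \<bullet> v - \<alpha>) \<le> ereal (z \<bullet> v) - f z \<omega>"
      by (cases "f z \<omega>") (auto simp: epi_def)
    also have "\<dots> \<le> (SUP z. ereal (z \<bullet> v) - f z \<omega>)"
      by (rule SUP_upper) simp
    finally show "ereal (z \<bullet> v - \<alpha>) \<le> (SUP z. ereal (z \<bullet> v) - f z \<omega>)" .
  qed
qed

text \<open>By the epigraph formula the conjugate exceeds \<open>c\<close> exactly when the epigraph
  contains a point satisfying a strict inequality between continuous functions, which is an open
  relation.\<close>

lemma conjugate_measurable:
  fixes f :: "'a::euclidean_space \<times> 'b::euclidean_space \<Rightarrow> 'w \<Rightarrow> ereal"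
  assumes f: "convex_normal_integrand M f" and v: "v \<in> borel_measurable M"
  shows "(\<lambda>\<omega>. conjugate f (v \<omega>) \<omega>) \<in> borel_measurable M"
proof (rule borel_measurableI_greater)
  fix c :: ereal
  let ?S = "\<lambda>\<omega>. epi (\<lambda>z. f z \<omega>)"
  define R :: "((('a \<times> 'b) \<times> real) \<times> ('a \<times> 'b)) set"
    where "R = {((z, \<alpha>), q). c < ereal (z \<bullet> q - \<alpha>)}"
  have "open R"
    unfolding R_def case_prod_unfold by (intro open_Collect_less continuous_intros)
  moreover have "measurable_mapping M ?S"
    using f by (simp add: convex_normal_integrand_def)
  ultimately have "{\<omega> \<in> space M. \<exists>s\<in>?S \<omega>. (s, v \<omega>) \<in> R} \<in> sets M"
    using v by (intro measurable_mapping_hits_open)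
  then show "{\<omega> \<in> space M. c < conjugate f (v \<omega>) \<omega>} \<in> sets M"
    unfolding conjugate_eq_SUP_epi less_SUP_iff by (simp add: R_def case_prod_unfold)
qed

section \<open>Fenchel's inequality and its equality case\<close>

text \<open>A subgradient \<open>v\<close> at \<open>z\<close> is precisely a \<open>v\<close> for
  which \<open>z\<close> attains the supremum defining the conjugate. Finiteness of both values
  permits real arithmetic.\<close>

lemma mem_subdifferential_iff_conjugate:
  assumes a: "f z \<omega> = ereal a" and b: "conjugate f v \<omega> = ereal b"
  shows "z \<bullet> v \<le> a + b"
    and "v \<in> subdifferential (\<lambda>z. f z \<omega>) z \<longleftrightarrow> a + b = z \<bullet> v"
proof -
  have le: "ereal (z' \<bullet> v) - f z' \<omega> \<le> ereal b" for z'
    unfolding b[symmetric] conjugate_eq_SUP by (rule SUP_upper) simp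
  show ge: "z \<bullet> v \<le> a + b"
    using le[of z] a by simp
  show "v \<in> subdifferential (\<lambda>z. f z \<omega>) z \<longleftrightarrow> a + b = z \<bullet> v"
  proof
    assume v: "v \<in> subdifferential (\<lambda>z. f z \<omega>) z"
    have "conjugate f v \<omega> \<le> ereal (z \<bullet> v - a)"
      unfolding conjugate_eq_SUP
    proof (rule SUP_least)
      fix z'
      have "ereal (a + v \<bullet> (z' - z)) \<le> f z' \<omega>"
        using v a by (simp add: subdifferential_def del: split_paired_All)
      then show "ereal (z' \<bullet> v) - f z' \<omega> \<le> ereal (z \<bullet> v - a)"
        by (cases "f z' \<omega>") (auto simp: inner_commute inner_diff)
    qed
    with ge show "a + b = z \<bullet> v"
      unfolding b by simp
  next
    assume eq: "a + b = z \<bullet> v"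
    have "ereal (a + v \<bullet> (z' - z)) \<le> f z' \<omega>" for z'
      using le[of z'] eq by (cases "f z' \<omega>") (auto simp: inner_commute inner_diff)
    then show "v \<in> subdifferential (\<lambda>z. f z \<omega>) z"
      using a by (simp add: subdifferential_def)
  qed
qed

section \<open>Orthogonality of unbounded adapted processes\<close>

text \<open>
  Induction over the index set. Restricting to the event \<open>\<bar>x k\<bar> \<le> n\<close> for the coordinate \<open>k\<close> with the
  smallest \<open>\<sigma>\<close>-algebra keeps all the other coordinates measurable and makes the \<open>k\<close>-th
  summand integrable with mean zero; then \<open>n\<close> tends to infinity.
\<close>

lemma adapted_orthogonal:
  fixes r :: "'i \<Rightarrow> nat" and x v :: "'i \<Rightarrow> 'w \<Rightarrow> real"
  assumes "finite I"
    and "\<And>i. i \<in> I \<Longrightarrow> subalgebra M (G i)"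
    and "\<And>i j. i \<in> I \<Longrightarrow> j \<in> I \<Longrightarrow> r i \<le> r j \<Longrightarrow> sets (G i) \<subseteq> sets (G j)"
    and "\<And>i. i \<in> I \<Longrightarrow> x i \<in> borel_measurable (G i)"
    and "\<And>i. i \<in> I \<Longrightarrow> integrable M (v i)"
    and "\<And>i g. i \<in> I \<Longrightarrow> g \<in> borel_measurable (G i) \<Longrightarrow> bounded (range g) \<Longrightarrow>
           (\<integral>\<omega>. g \<omega> * v i \<omega> \<partial>M) = 0"
    and "integrable M (\<lambda>\<omega>. max 0 (\<Sum>i\<in>I. x i \<omega> * v i \<omega>))"
  shows "integrable M (\<lambda>\<omega>. \<Sum>i\<in>I. x i \<omega> * v i \<omega>) \<and> (\<integral>\<omega>. (\<Sum>i\<in>I. x i \<omega> * v i \<omega>) \<partial>M) = 0"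
  using assms
\<comment> \<open>The induction hypothesis is applied to the truncations of \<open>x\<close>, so
  \<open>x\<close> has to be generalized.\<close>
proof (induction I arbitrary: x rule: finite_psubset_induct)
  case (psubset I)
  note sub = psubset.prems(1) and mono = psubset.prems(2) and x = psubset.prems(3)
    and v = psubset.prems(4) and orth = psubset.prems(5) and pos = psubset.prems(6)
  show ?case
  proof (cases "I = {}")
    case False
    define k where "k = arg_min_on r I"
    have k: "k \<in> I" "\<And>j. j \<in> I \<Longrightarrow> r k \<le> r j"
      using False psubset.hyps by (auto simp: k_def arg_min_if_finite arg_min_least)
    have xM: "x i \<in> borel_measurable M" and vM: "v i \<in> borel_measurable M" if "i \<in> I" for i
      using that sub x v measurable_from_subalg borel_measurable_integrable by blast+
    define S where "S \<omega> = (\<Sum>i\<in>I. x i \<omega> * v i \<omega>)" for \<omega>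
    have S[measurable]: "S \<in> borel_measurable M"
      unfolding S_def[abs_def] using xM vM by (intro borel_measurable_sum borel_measurable_times) auto
    have S_pos: "integrable M (\<lambda>\<omega>. max 0 (S \<omega>))"
      using pos by (simp add: S_def)
    define A where "A n = {\<omega> \<in> space M. \<bar>x k \<omega>\<bar> \<le> real n}" for n
    have A_G: "A n \<in> sets (G j)" if "j \<in> I" for n j
    proof -
      have "space (G k) = space M"
        using sub[OF k(1)] by (simp add: subalgebra_def)
      then have "A n = {\<omega> \<in> space (G k). \<bar>x k \<omega>\<bar> \<le> real n}"
        by (simp add: A_def)
      also have "\<dots> \<in> sets (G k)"
        using x[OF k(1)] by measurable
      finally show ?thesis
        using mono[OF k(1) that k(2)[OF that]] by blast
    qed
    then have A_M[measurable]: "A n \<in> sets M" for n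
      using k(1) sub[OF k(1)] by (auto simp: subalgebra_def)
    let ?S = "\<lambda>n \<omega>. indicat_real (A n) \<omega> * S \<omega>"
    have stage: "integrable M (?S n) \<and> (\<integral>\<omega>. ?S n \<omega> \<partial>M) = 0" for n
    proof -
      define x' where "x' i \<omega> = indicat_real (A n) \<omega> * x i \<omega>" for i \<omega>
      have x': "x' i \<in> borel_measurable (G i)" if "i \<in> I" for i
        unfolding x'_def[abs_def] using x[OF that] A_G[OF that]
        by (intro borel_measurable_times borel_measurable_indicator)
      \<comment> \<open>Outside \<open>space M\<close> the indicator vanishes, so the bound holds at
        every point, as boundedness of the full range demands.\<close>
      have bnd: "\<bar>x' k \<omega>\<bar> \<le> real n" for \<omega>
        by (auto simp: x'_def A_def indicator_def)
      then have k_bdd: "bounded (range (x' k))"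
        by (auto simp: bounded_iff intro!: exI[of _ "real n"])
      have k_int: "integrable M (\<lambda>\<omega>. x' k \<omega> * v k \<omega>)"
      proof (rule Bochner_Integration.integrable_bound)
        show "integrable M (\<lambda>\<omega>. real n * v k \<omega>)"
          using v[OF k(1)] by simp
        show "(\<lambda>\<omega>. x' k \<omega> * v k \<omega>) \<in> borel_measurable M"
          unfolding x'_def[abs_def] using xM[OF k(1)] vM[OF k(1)] by measurable
        show "AE \<omega> in M. norm (x' k \<omega> * v k \<omega>) \<le> norm (real n * v k \<omega>)"
          using bnd by (intro AE_I2) (simp add: abs_mult mult_right_mono)
      qed
      have k_0: "(\<integral>\<omega>. x' k \<omega> * v k \<omega> \<partial>M) = 0"
        using orth[OF k(1) x'[OF k(1)] k_bdd] .
      let ?R = "\<lambda>\<omega>. \<Sum>i\<in>I - {k}. x' i \<omega> * v i \<omega>"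
      have split: "?S n \<omega> = x' k \<omega> * v k \<omega> + ?R \<omega>" for \<omega>
        unfolding S_def sum_distrib_left x'_def
        using sum.remove[OF psubset.hyps k(1), of "\<lambda>i. indicat_real (A n) \<omega> * (x i \<omega> * v i \<omega>)"]
        by (simp add: mult.assoc)
      have R_int: "integrable M ?R \<and> (\<integral>\<omega>. ?R \<omega> \<partial>M) = 0"
      proof (rule psubset.IH)
        show "I - {k} \<subset> I"
          using k(1) by blast
        have R_M: "?R \<in> borel_measurable M"
          unfolding x'_def[abs_def] using xM vM
          by (intro borel_measurable_sum borel_measurable_times borel_measurable_indicator) auto
        \<comment> \<open>The remainder is the truncated sum minus the \<open>k\<close>-th term.
          Truncation does not increase the positive part of \<open>S\<close>, so the positive part
          of the remainder is at most that of \<open>S\<close> plus the modulus of the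
          \<open>k\<close>-th term.\<close>
        show "integrable M (\<lambda>\<omega>. max 0 (?R \<omega>))"
        proof (rule Bochner_Integration.integrable_bound)
          show "integrable M (\<lambda>\<omega>. max 0 (S \<omega>) + \<bar>x' k \<omega> * v k \<omega>\<bar>)"
            using S_pos k_int by (intro Bochner_Integration.integrable_add) auto
          show "(\<lambda>\<omega>. max 0 (?R \<omega>)) \<in> borel_measurable M"
            using R_M by measurable
          show "AE \<omega> in M. norm (max 0 (?R \<omega>)) \<le> norm (max 0 (S \<omega>) + \<bar>x' k \<omega> * v k \<omega>\<bar>)"
          proof (intro AE_I2)
            fix \<omega>
            have "?R \<omega> = ?S n \<omega> - x' k \<omega> * v k \<omega>"
              using split by simp
            moreover have "?S n \<omega> \<le> max 0 (S \<omega>)"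
              by (auto simp: indicator_def)
            ultimately show "norm (max 0 (?R \<omega>)) \<le> norm (max 0 (S \<omega>) + \<bar>x' k \<omega> * v k \<omega>\<bar>)"
              by auto
          qed
        qed
      qed (use sub mono x' v orth in auto)
      show ?thesis
        unfolding split using k_int k_0 R_int by simp
    qed
    \<comment> \<open>As the truncated sums have mean zero, their negative and positive parts have
      equal integrals, bounded for all \<open>n\<close> by the integral of
      \<open>max 0 (S \<omega>)\<close>. Monotone convergence then makes the negative part of
      \<open>S\<close> integrable.\<close>
    let ?P = "\<lambda>n \<omega>. indicat_real (A n) \<omega> * max 0 (S \<omega>)"
    let ?N = "\<lambda>n \<omega>. indicat_real (A n) \<omega> * max 0 (- S \<omega>)"
    have PN: "?N n = (\<lambda>\<omega>. ?P n \<omega> - ?S n \<omega>)" for n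
      by (auto simp: fun_eq_iff max_def indicator_def)
    have P_int: "integrable M (?P n)" for n
      using integrable_mult_indicator[OF A_M S_pos] by simp
    have N_int: "integrable M (?N n)" for n
      unfolding PN using P_int stage by simp
    have N_le: "(\<integral>\<omega>. ?N n \<omega> \<partial>M) \<le> (\<integral>\<omega>. max 0 (S \<omega>) \<partial>M)" for n
    proof -
      have "(\<integral>\<omega>. ?N n \<omega> \<partial>M) = (\<integral>\<omega>. ?P n \<omega> \<partial>M)"
        unfolding PN using P_int stage by (subst Bochner_Integration.integral_diff) auto
      also have "\<dots> \<le> (\<integral>\<omega>. max 0 (S \<omega>) \<partial>M)"
        using P_int S_pos by (intro integral_mono) (auto simp: indicator_def)
      finally show ?thesis .
    qed
    have ev: "\<forall>\<^sub>F n in sequentially. \<omega> \<in> A n" if "\<omega> \<in> space M" for \<omega>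
    proof -
      obtain n0 where "\<bar>x k \<omega>\<bar> \<le> real n0"
        using real_arch_simple by blast
      with that show ?thesis
        by (intro eventually_sequentiallyI[of n0]) (auto simp: A_def)
    qed
    have lim: "(\<lambda>n. indicat_real (A n) \<omega> * c) \<longlonglongrightarrow> c" if "\<omega> \<in> space M" for \<omega> c
      by (rule tendsto_eventually, rule eventually_mono[OF ev[OF that]]) simp
    have A_mono: "A m \<subseteq> A n" if "m \<le> n" for m n
      using that by (auto simp: A_def)
    have inc: "incseq (\<lambda>n. \<integral>\<omega>. ?N n \<omega> \<partial>M)"
    proof (intro incseq_SucI integral_mono N_int)
      fix n \<omega>
      show "?N n \<omega> \<le> ?N (Suc n) \<omega>"
        using A_mono[of n "Suc n"] by (auto simp: indicator_def)
    qed
    obtain L where L: "(\<lambda>n. \<integral>\<omega>. ?N n \<omega> \<partial>M) \<longlonglongrightarrow> L"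
      using incseq_convergent[OF inc] N_le by blast
    have neg: "integrable M (\<lambda>\<omega>. max 0 (- S \<omega>))"
    proof (rule integrable_monotone_convergence[OF N_int _ _ L])
      show "AE \<omega> in M. mono (\<lambda>n. ?N n \<omega>)"
        using A_mono by (intro AE_I2 monoI) (auto simp: indicator_def)
      show "AE \<omega> in M. (\<lambda>n. ?N n \<omega>) \<longlonglongrightarrow> max 0 (- S \<omega>)"
        using lim by (intro AE_I2) auto
    qed measurable
    have "S = (\<lambda>\<omega>. max 0 (S \<omega>) - max 0 (- S \<omega>))"
      by (auto simp: fun_eq_iff)
    then have S_int: "integrable M S"
      using Bochner_Integration.integrable_diff[OF S_pos neg] by simp
    \<comment> \<open>Now \<open>\<bar>S\<bar>\<close> dominates the truncations, so their zero
      means pass to the limit.\<close>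
    have "(\<lambda>n. \<integral>\<omega>. ?S n \<omega> \<partial>M) \<longlonglongrightarrow> (\<integral>\<omega>. S \<omega> \<partial>M)"
    proof (rule integral_dominated_convergence)
      show "integrable M (\<lambda>\<omega>. \<bar>S \<omega>\<bar>)"
        using S_int by simp
      show "AE \<omega> in M. (\<lambda>n. ?S n \<omega>) \<longlonglongrightarrow> S \<omega>"
        using lim by (intro AE_I2) auto
    qed (auto simp: indicator_def)
    then have "(\<integral>\<omega>. S \<omega> \<partial>M) = 0"
      using stage by (simp add: LIMSEQ_const_iff)
    with S_int show ?thesis
      by (simp add: S_def[abs_def])
  qed simp
qed

section \<open>Pointwise biconjugation and the Lagrangian\<close>

text \<open>Otherwise \<open>(u, \<gamma>)\<close> could be strictly separated from the epigraph by
  a hyperplane. If it is not vertical, it is the graph of an affine minorant of \<open>g\<close>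
  lying above \<gamma> at \<open>u\<close>, and its slope violates \<open>conj\<close>.\<close>

lemma closed_convex_le_biconjugate:
  fixes g :: "'b::euclidean_space \<Rightarrow> ereal"
  assumes "convex (epi g)" "closed (epi g)" "g u < \<infinity>"
    and conj: "\<And>y. ereal (u \<bullet> y - \<gamma>) \<le> (SUP u'. ereal (u' \<bullet> y) - g u')"
  shows "g u \<le> ereal \<gamma>"
proof (rule ccontr)
  assume less: "\<not> g u \<le> ereal \<gamma>"
  then have "(u, \<gamma>) \<notin> epi g"
    by (simp add: epi_def)
  then obtain q c where q: "q \<bullet> (u, \<gamma>) < c" "\<And>s. s \<in> epi g \<Longrightarrow> c < q \<bullet> s"
    using separating_hyperplane_closed_point[OF assms(1,2)] by blast
  obtain a b where ab: "q = (a, b)"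
    by fastforce
  have sep1: "a \<bullet> u + b * \<gamma> < c"
    using q(1) by (simp add: ab inner_prod_def)
  have sep2: "c < a \<bullet> u' + b * \<alpha>" if "g u' \<le> ereal \<alpha>" for u' \<alpha>
    using q(2)[of "(u', \<alpha>)"] that by (simp add: ab inner_prod_def epi_def)
  obtain \<alpha> where \<alpha>: "g u \<le> ereal \<alpha>" "\<gamma> < \<alpha>"
  proof (cases "g u")
    case (real r)
    then show ?thesis
      using that[of r] less by simp
  qed (use assms(3) less in auto)
  \<comment> \<open>Finiteness at \<open>u\<close> rules out a vertical separating hyperplane.\<close>
  have "b * \<gamma> < b * \<alpha>"
    using sep1 sep2[OF \<alpha>(1)] by linarith
  then have b: "b > 0"
    using \<alpha>(2) by (simp add: mult_less_cancel_left)
  \<comment> \<open>Dividing by \<open>b > 0\<close> turns the half-space into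
    \<open>u' \<bullet> y + c / b < \<alpha>\<close>: the slope of the minorant is \<open>y\<close>,
    and its constant term \<open>c / b\<close> bounds the conjugate at \<open>y\<close> by
    \<open>- c / b\<close>.\<close>
  define y where "y = (- 1 / b) *\<^sub>R a"
  have y: "u' \<bullet> y = - (a \<bullet> u') / b" for u'
    by (simp add: y_def inner_commute)
  have "(SUP u'. ereal (u' \<bullet> y) - g u') \<le> ereal (- c / b)"
  proof (rule SUP_least)
    fix u'
    show "ereal (u' \<bullet> y) - g u' \<le> ereal (- c / b)"
    proof (cases "g u'")
      case (real r)
      then have "c / b \<le> (a \<bullet> u' + b * r) / b"
        using sep2[of u' r] b by (intro divide_right_mono) auto
      with real b show ?thesis
        by (simp add: y add_divide_distrib)
    next
      \<comment> \<open>The epigraph would contain the point over \<open>u'\<close> at height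
        \<open>(c - a \<bullet> u') / b\<close>, which lies on the hyperplane, against strict
        separation.\<close>
      case MInf
      then show ?thesis
        using sep2[of u' "(c - a \<bullet> u') / b"] b by simp
    qed simp
  qed
  with conj[of y] have "ereal (u \<bullet> y - \<gamma>) \<le> ereal (- c / b)"
    by (rule order_trans)
  moreover have "(a \<bullet> u + b * \<gamma>) / b < c / b"
    using sep1 b by (rule divide_strict_right_mono)
  ultimately show False
    using b by (simp add: y add_divide_distrib)
qed

text \<open>This identifies the negative Lagrangian with the conjugate of \<open>f (x, _)\<close> in
  the second argument, so that the biconjugate inequality applies to its subgradients.\<close>

lemma uminus_lagrangian: "- lagrangian f x y \<omega> = (SUP u. ereal (u \<bullet> y) - f (x, u) \<omega>)"
proof -
  have "- (f (x, u) \<omega> - ereal (u \<bullet> y)) = ereal (u \<bullet> y) - f (x, u) \<omega>" for u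
    by (cases "f (x, u) \<omega>") auto
  then show ?thesis
    unfolding lagrangian_def by (simp flip: ereal_SUP_uminus_eq add: image_comp)
qed

text \<open>From left to right, minimize the subgradient inequality over \<open>u'\<close>.
  Conversely, the condition on \<open>u\<close> bounds the biconjugate of the slice
  \<open>f (x, _)\<close> at \<open>u\<close>, hence \<open>f (x, u)\<close> itself, by
  \<open>l (x, y) + u \<bullet> y\<close>; the condition on \<open>p\<close> and
  \<open>l (x', y) \<le> f (x', u') - u' \<bullet> y\<close> give the rest.\<close>

lemma mem_subdifferential_iff_lagrangian:
  fixes f :: "'a::real_inner \<times> 'b::euclidean_space \<Rightarrow> 'w \<Rightarrow> ereal"
  assumes f: "ext_convex (\<lambda>z. f z \<omega>)" "closed_fun (\<lambda>z. f z \<omega>)" and fin: "f (x, u) \<omega> < \<infinity>"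
  shows "(p, y) \<in> subdifferential (\<lambda>z. f z \<omega>) (x, u) \<longleftrightarrow>
    p \<in> subdifferential (\<lambda>x'. lagrangian f x' y \<omega>) x \<and>
    u \<in> subdifferential (\<lambda>y'. - lagrangian f x y' \<omega>) y" (is "?L \<longleftrightarrow> ?R")
proof
  assume ?L
  then obtain a where a: "f (x, u) \<omega> = ereal a"
    and sub: "\<And>x' u'. ereal (a + (p \<bullet> (x' - x) + y \<bullet> (u' - u))) \<le> f (x', u') \<omega>"
    by (cases "f (x, u) \<omega>") (auto simp: subdifferential_def inner_prod_def)
  have ge: "ereal (a - u \<bullet> y + p \<bullet> (x' - x)) \<le> lagrangian f x' y \<omega>" for x'
    unfolding lagrangian_def
  proof (rule INF_greatest)
    fix u'
    show "ereal (a - u \<bullet> y + p \<bullet> (x' - x)) \<le> f (x', u') \<omega> - ereal (u' \<bullet> y)"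
      using sub[of x' u'] by (cases "f (x', u') \<omega>") (auto simp: inner_diff inner_commute)
  qed
  have le: "lagrangian f x y' \<omega> \<le> ereal (a - u \<bullet> y')" for y'
    unfolding lagrangian_def using a by (intro INF_lower2[of u]) auto
  have eq: "lagrangian f x y \<omega> = ereal (a - u \<bullet> y)"
    using le[of y] ge[of x] by (intro antisym) auto
  have "ereal (u \<bullet> y - a + u \<bullet> (y' - y)) \<le> - lagrangian f x y' \<omega>" for y'
    using le[of y'] by (cases "lagrangian f x y' \<omega>") (auto simp: inner_diff)
  with ge eq show ?R
    by (simp add: subdifferential_def)
next
  assume R: ?R
  then obtain b where b: "lagrangian f x y \<omega> = ereal b"
    by (cases "lagrangian f x y \<omega>") (auto simp: subdifferential_def)
  have l: "ereal (b + p \<bullet> (x' - x)) \<le> lagrangian f x' y \<omega>" for x'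
    using R b by (simp add: subdifferential_def)
  \<comment> \<open>Rearranged to match the conjugate bound in
    \<open>closed_convex_le_biconjugate\<close> with \<gamma> equal to
    \<open>b + u \<bullet> y\<close>.\<close>
  have u: "ereal (u \<bullet> y' - (b + u \<bullet> y)) \<le> - lagrangian f x y' \<omega>" for y'
    using R b by (simp add: subdifferential_def inner_diff algebra_simps)
  \<comment> \<open>The slice has as epigraph the preimage of the joint one under an affine
    embedding; convex combinations leave the fixed \<open>x\<close> unchanged because the weights
    sum to 1.\<close>
  have cv: "convex (epi (\<lambda>u. f (x, u) \<omega>))"
  proof (rule convexI)
    fix s t :: "'b \<times> real" and \<mu> \<nu> :: real
    assume st: "s \<in> epi (\<lambda>u. f (x, u) \<omega>)" "t \<in> epi (\<lambda>u. f (x, u) \<omega>)"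
      and \<mu>\<nu>: "0 \<le> \<mu>" "0 \<le> \<nu>" "\<mu> + \<nu> = 1"
    have "\<mu> *\<^sub>R ((x, fst s), snd s) + \<nu> *\<^sub>R ((x, fst t), snd t) \<in> epi (\<lambda>z. f z \<omega>)"
      using f(1) st \<mu>\<nu> unfolding ext_convex_def by (intro convexD) (auto simp: epi_def)
    moreover have "\<mu> *\<^sub>R x + \<nu> *\<^sub>R x = x"
      using \<mu>\<nu>(3) by (simp flip: scaleR_left_distrib)
    ultimately show "\<mu> *\<^sub>R s + \<nu> *\<^sub>R t \<in> epi (\<lambda>u. f (x, u) \<omega>)"
      by (cases s; cases t) (simp add: epi_def)
  qed
  have "epi (\<lambda>u. f (x, u) \<omega>) = (\<lambda>s. ((x, fst s), snd s)) -` epi (\<lambda>z. f z \<omega>)"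
    by (auto simp: epi_def)
  moreover have "closed (epi (\<lambda>z. f z \<omega>))"
    using f(2) by (intro closed_epi) (simp add: closed_fun_def)
  ultimately have cl: "closed (epi (\<lambda>u. f (x, u) \<omega>))"
    by (auto intro!: closed_vimage continuous_intros)
  have le: "f (x, u) \<omega> \<le> ereal (b + u \<bullet> y)"
    using closed_convex_le_biconjugate[OF cv cl fin] u unfolding uminus_lagrangian by blast
  have sub: "ereal (b + u \<bullet> y + (p \<bullet> (x' - x) + y \<bullet> (u' - u))) \<le> f (x', u') \<omega>" for x' u'
  proof -
    have "lagrangian f x' y \<omega> \<le> f (x', u') \<omega> - ereal (u' \<bullet> y)"
      unfolding lagrangian_def by (rule INF_lower) simp
    with l[of x'] have "ereal (b + p \<bullet> (x' - x)) \<le> f (x', u') \<omega> - ereal (u' \<bullet> y)"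
      by (rule order_trans)
    then show ?thesis
      by (cases "f (x', u') \<omega>") (auto simp: inner_diff inner_commute)
  qed
  have "f (x, u) \<omega> = ereal (b + u \<bullet> y)"
    using le sub[of x u] by (intro antisym) auto
  with sub show ?L
    by (simp add: subdifferential_def inner_prod_def)
qed

section \<open>Extended expectations and the duality gap\<close>

lemma ext_expectation_AE_real:
  assumes r: "integrable M r" and eq: "AE \<omega> in M. \<xi> \<omega> = ereal (r \<omega>)"
  shows "ext_expectation M \<xi> = ereal (\<integral>\<omega>. r \<omega> \<partial>M)"
proof -
  obtain a b where ab: "0 \<le> a" "0 \<le> b" "(\<integral>\<^sup>+\<omega>. ennreal (r \<omega>) \<partial>M) = ennreal a"
      "(\<integral>\<^sup>+\<omega>. ennreal (- r \<omega>) \<partial>M) = ennreal b" "(\<integral>\<omega>. r \<omega> \<partial>M) = a - b"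
    using r by (rule integrableE) blast
  have "(\<integral>\<^sup>+\<omega>. e2ennreal (\<xi> \<omega>) \<partial>M) = (\<integral>\<^sup>+\<omega>. ennreal (r \<omega>) \<partial>M)"
    by (rule nn_integral_cong_AE) (use eq in eventually_elim, simp)
  moreover have "(\<integral>\<^sup>+\<omega>. e2ennreal (- \<xi> \<omega>) \<partial>M) = (\<integral>\<^sup>+\<omega>. ennreal (- r \<omega>) \<partial>M)"
    by (rule nn_integral_cong_AE) (use eq in eventually_elim, simp)
  ultimately show ?thesis
    using ab by (simp add: ext_expectation_def enn2ereal_ennreal)
qed

text \<open>A value below \<infinity> means that the positive part has finite integral; nothing is
  said about the negative part. The default \<open>real_of_ereal (- \<infinity>) = 0\<close> is
  harmless under \<open>max 0\<close>.\<close>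

lemma ext_expectation_less_top:
  assumes \<xi>[measurable]: "\<xi> \<in> borel_measurable M" and "ext_expectation M \<xi> < \<infinity>"
  shows "AE \<omega> in M. \<xi> \<omega> < \<infinity>" and "integrable M (\<lambda>\<omega>. max 0 (real_of_ereal (\<xi> \<omega>)))"
proof -
  have fin: "(\<integral>\<^sup>+\<omega>. e2ennreal (\<xi> \<omega>) \<partial>M) \<noteq> \<infinity>"
    using assms(2) by (auto simp: ext_expectation_def split: if_splits)
  then have "AE \<omega> in M. e2ennreal (\<xi> \<omega>) \<noteq> \<infinity>"
    by (intro nn_integral_PInf_AE) auto
  then show AE: "AE \<omega> in M. \<xi> \<omega> < \<infinity>"
    by eventually_elim (auto simp: less_top[symmetric])
  have "(\<integral>\<^sup>+\<omega>. ennreal (norm (max 0 (real_of_ereal (\<xi> \<omega>)))) \<partial>M) \<le> (\<integral>\<^sup>+\<omega>. e2ennreal (\<xi> \<omega>) \<partial>M)"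
  proof (rule nn_integral_mono_AE, use AE in eventually_elim)
    fix \<omega> assume "\<xi> \<omega> < \<infinity>"
    then show "ennreal (norm (max 0 (real_of_ereal (\<xi> \<omega>)))) \<le> e2ennreal (\<xi> \<omega>)"
      by (cases "\<xi> \<omega>") (auto simp: max_def ennreal_neg)
  qed
  also have "\<dots> < \<infinity>"
    using fin by (simp add: less_top)
  finally show "integrable M (\<lambda>\<omega>. max 0 (real_of_ereal (\<xi> \<omega>)))"
    by (intro integrableI_bounded) auto
qed

text \<open>The hypothesis \<open>xp\<close> is conditional because Fenchel's inequality controls
  only the positive part of \<open>x \<bullet> p\<close> at first. Once \<open>x \<bullet> p\<close>
  is integrable, the same inequality bounds both integrands below by integrable functions, so both
  values are finite.\<close>

lemma integral_functional_duality_gap: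
  fixes f :: "'a::euclidean_space \<times> 'b::euclidean_space \<Rightarrow> 'w \<Rightarrow> ereal"
  assumes f: "convex_normal_integrand M f"
    and meas[measurable]: "x \<in> borel_measurable M" "u \<in> borel_measurable M"
      "p \<in> borel_measurable M" "y \<in> borel_measurable M"
    and Ef: "integral_functional M f x u < \<infinity>"
    and Ec: "integral_functional M (conjugate f) p y < \<infinity>"
    and uy: "integrable M (\<lambda>\<omega>. u \<omega> \<bullet> y \<omega>)"
    and xp: "integrable M (\<lambda>\<omega>. max 0 (x \<omega> \<bullet> p \<omega>)) \<Longrightarrow>
      integrable M (\<lambda>\<omega>. x \<omega> \<bullet> p \<omega>) \<and> pairing M x p = 0"
  obtains a b where "integral_functional M f x u = ereal a"
    and "integral_functional M (conjugate f) p y = ereal b"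
    and "pairing M u y \<le> a + b"
    and "a + b = pairing M u y \<longleftrightarrow>
      (AE \<omega> in M. (p \<omega>, y \<omega>) \<in> subdifferential (\<lambda>z. f z \<omega>) (x \<omega>, u \<omega>))"
proof -
  let ?F = "\<lambda>\<omega>. f (x \<omega>, u \<omega>) \<omega>" and ?C = "\<lambda>\<omega>. conjugate f (p \<omega>, y \<omega>) \<omega>"
  define a b where "a \<omega> = real_of_ereal (?F \<omega>)" and "b \<omega> = real_of_ereal (?C \<omega>)" for \<omega>
  have F[measurable]: "?F \<in> borel_measurable M"
    using normal_integrand_measurable[OF f, of "\<lambda>\<omega>. (x \<omega>, u \<omega>)"] by simp
  have C[measurable]: "?C \<in> borel_measurable M"
    using conjugate_measurable[OF f, of "\<lambda>\<omega>. (p \<omega>, y \<omega>)"] by simp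
  have [measurable]: "a \<in> borel_measurable M" "b \<in> borel_measurable M"
    unfolding a_def[abs_def] b_def[abs_def] by measurable
  have F_top: "AE \<omega> in M. ?F \<omega> < \<infinity>" and a_pos: "integrable M (\<lambda>\<omega>. max 0 (a \<omega>))"
    using ext_expectation_less_top[OF F] Ef by (auto simp: integral_functional_def a_def)
  have C_top: "AE \<omega> in M. ?C \<omega> < \<infinity>" and b_pos: "integrable M (\<lambda>\<omega>. max 0 (b \<omega>))"
    using ext_expectation_less_top[OF C] Ec by (auto simp: integral_functional_def b_def)
  \<comment> \<open>If one of the two values were -\<infinity>, the extended Fenchel inequality
    would force the other to be \<infinity>, which is already excluded almost surely.\<close>
  have real: "AE \<omega> in M. ?F \<omega> = ereal (a \<omega>) \<and> ?C \<omega> = ereal (b \<omega>)"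
    using F_top C_top
  proof eventually_elim
    fix \<omega> assume top: "?F \<omega> < \<infinity>" "?C \<omega> < \<infinity>"
    have "ereal ((x \<omega>, u \<omega>) \<bullet> (p \<omega>, y \<omega>)) - ?F \<omega> \<le> ?C \<omega>"
      unfolding conjugate_eq_SUP by (rule SUP_upper) simp
    with top show "?F \<omega> = ereal (a \<omega>) \<and> ?C \<omega> = ereal (b \<omega>)"
      unfolding a_def b_def by (cases "?F \<omega>"; cases "?C \<omega>") auto
  qed
  have fy: "AE \<omega> in M. x \<omega> \<bullet> p \<omega> + u \<omega> \<bullet> y \<omega> \<le> a \<omega> + b \<omega>"
    using real
  proof eventually_elim
    fix \<omega> assume "?F \<omega> = ereal (a \<omega>) \<and> ?C \<omega> = ereal (b \<omega>)"
    then have "(x \<omega>, u \<omega>) \<bullet> (p \<omega>, y \<omega>) \<le> a \<omega> + b \<omega>"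
      using mem_subdifferential_iff_conjugate(1)[of f "(x \<omega>, u \<omega>)" \<omega> "a \<omega>"] by blast
    then show "x \<omega> \<bullet> p \<omega> + u \<omega> \<bullet> y \<omega> \<le> a \<omega> + b \<omega>"
      by (simp add: inner_prod_def)
  qed
  have "integrable M (\<lambda>\<omega>. max 0 (x \<omega> \<bullet> p \<omega>))"
  proof (rule Bochner_Integration.integrable_bound)
    show "integrable M (\<lambda>\<omega>. max 0 (a \<omega>) + max 0 (b \<omega>) + \<bar>u \<omega> \<bullet> y \<omega>\<bar>)"
      using a_pos b_pos uy by simp
    show "AE \<omega> in M. norm (max 0 (x \<omega> \<bullet> p \<omega>)) \<le> norm (max 0 (a \<omega>) + max 0 (b \<omega>) + \<bar>u \<omega> \<bullet> y \<omega>\<bar>)"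
      using fy by eventually_elim auto
  qed measurable
  then have xp_int: "integrable M (\<lambda>\<omega>. x \<omega> \<bullet> p \<omega>)" and xp_0: "pairing M x p = 0"
    using conjunct1[OF xp] conjunct2[OF xp] by blast+
  \<comment> \<open>One dominating function serves both integrands: each lies below its own positive
    part and above \<open>x \<bullet> p + u \<bullet> y\<close> minus the positive part of the
    other.\<close>
  have dom: "integrable M (\<lambda>\<omega>. max 0 (a \<omega>) + max 0 (b \<omega>) + \<bar>u \<omega> \<bullet> y \<omega>\<bar> + \<bar>x \<omega> \<bullet> p \<omega>\<bar>)"
    using a_pos b_pos uy xp_int by simp
  have a_int: "integrable M a"
    by (rule Bochner_Integration.integrable_bound[OF dom])
      (measurable, use fy in eventually_elim, auto)
  have b_int: "integrable M b"
    by (rule Bochner_Integration.integrable_bound[OF dom])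
      (measurable, use fy in eventually_elim, auto)
  let ?gap = "\<lambda>\<omega>. a \<omega> + b \<omega> - (x \<omega> \<bullet> p \<omega> + u \<omega> \<bullet> y \<omega>)"
  have gap_int: "integrable M ?gap"
    using a_int b_int xp_int uy by simp
  have gap: "integral\<^sup>L M ?gap = integral\<^sup>L M a + integral\<^sup>L M b - pairing M u y"
    using a_int b_int xp_int uy xp_0 by (simp add: pairing_def)
  have gap_nonneg: "AE \<omega> in M. 0 \<le> ?gap \<omega>"
    using fy by eventually_elim simp
  show thesis
  proof (rule that)
    show "integral_functional M f x u = ereal (integral\<^sup>L M a)"
      unfolding integral_functional_def using real by (intro ext_expectation_AE_real a_int) auto
    show "integral_functional M (conjugate f) p y = ereal (integral\<^sup>L M b)"
      unfolding integral_functional_def using real by (intro ext_expectation_AE_real b_int) auto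
    show "pairing M u y \<le> integral\<^sup>L M a + integral\<^sup>L M b"
      using integral_nonneg_AE[OF gap_nonneg] gap by simp
    have "integral\<^sup>L M a + integral\<^sup>L M b = pairing M u y \<longleftrightarrow> integral\<^sup>L M ?gap = 0"
      unfolding gap by auto
    also have "\<dots> \<longleftrightarrow> (AE \<omega> in M. ?gap \<omega> = 0)"
      by (rule integral_nonneg_eq_0_iff_AE[OF gap_int gap_nonneg])
    also have "\<dots> \<longleftrightarrow> (AE \<omega> in M. (p \<omega>, y \<omega>) \<in> subdifferential (\<lambda>z. f z \<omega>) (x \<omega>, u \<omega>))"
    proof -
      have "AE \<omega> in M. ?gap \<omega> = 0 \<longleftrightarrow>
          (p \<omega>, y \<omega>) \<in> subdifferential (\<lambda>z. f z \<omega>) (x \<omega>, u \<omega>)"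
        using real by eventually_elim (auto simp: mem_subdifferential_iff_conjugate(2))
      then show ?thesis
        by (rule eventually_subst)
    qed
    finally show "integral\<^sup>L M a + integral\<^sup>L M b = pairing M u y \<longleftrightarrow>
        (AE \<omega> in M. (p \<omega>, y \<omega>) \<in> subdifferential (\<lambda>z. f z \<omega>) (x \<omega>, u \<omega>))" .
  qed
qed

section \<open>Adapted strategies against the orthogonal complement\<close>

text \<open>Gluing zero on the empty event to \<open>u\<close> by decomposability yields a function
  equal to \<open>u\<close> on \<open>space M\<close> but zero outside it; solidity then passes to
  \<open>u\<close> itself.\<close>

lemma ess_bounded_subset:
  fixes X :: "('w \<Rightarrow> real ^ 'n::finite) set"
  assumes X: "rv_space M X" "solid M X" "decomposable M X"
  shows "ess_bounded M \<subseteq> X"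
proof
  fix u :: "'w \<Rightarrow> real ^ 'n" assume u: "u \<in> ess_bounded M"
  have 0: "(\<lambda>_. 0) \<in> X"
    using X(1) by (simp add: rv_space_def)
  have w: "(\<lambda>\<omega>. indicat_real {} \<omega> *\<^sub>R 0 + indicat_real (space M - {}) \<omega> *\<^sub>R u \<omega>) \<in> X"
    using X(3)[unfolded decomposable_def, rule_format, OF 0 u sets.empty_sets] .
  have "AE \<omega> in M. \<bar>u \<omega> $ i\<bar> \<le>
      \<bar>(indicat_real {} \<omega> *\<^sub>R 0 + indicat_real (space M - {}) \<omega> *\<^sub>R u \<omega>) $ i\<bar>" for i
    by (intro AE_I2) simp
  moreover have "u \<in> borel_measurable M"
    using u by (simp add: ess_bounded_def)
  ultimately show "u \<in> X"
    using X(2)[unfolded solid_def, rule_format, OF w] by blast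
qed

text \<open>Testing \<open>p\<close> with bounded strategies supported on a single coordinate gives
  the coordinatewise orthogonality required by \<open>adapted_orthogonal\<close>, with
  \<open>stage\<close> as the rank.\<close>

lemma adapted_pairing_eq_0:
  fixes x p :: "'w \<Rightarrow> real ^ 'n::finite"
  assumes F: "discrete_filtration M T F" and stage: "\<forall>i. stage i \<le> T"
    and X: "rv_space M X" "solid M X" "decomposable M X" and V: "rv_space M V"
    and dual: "separating_duality M X V"
    and x: "x \<in> adapted_strategies M F stage"
    and p: "p \<in> orth_complement M V (X \<inter> adapted_strategies M F stage)"
    and pos: "integrable M (\<lambda>\<omega>. max 0 (x \<omega> \<bullet> p \<omega>))"
  shows "integrable M (\<lambda>\<omega>. x \<omega> \<bullet> p \<omega>) \<and> pairing M x p = 0"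
proof -
  have pV: "p \<in> V"
    using p by (simp add: orth_complement_def)
  then have [measurable]: "p \<in> borel_measurable M"
    using V by (auto simp: rv_space_def)
  have [measurable]: "x \<in> borel_measurable M"
    using x by (simp add: adapted_strategies_def)
  have sub: "subalgebra M (F (stage i))" for i
    using F stage by (simp add: discrete_filtration_def)
  \<comment> \<open>The coordinates of \<open>x\<close> are adapted only up to null sets, so
    strictly measurable representatives replace them.\<close>
  obtain g where g: "\<And>i. g i \<in> borel_measurable (F (stage i))" "\<And>i. AE \<omega> in M. x \<omega> $ i = g i \<omega>"
    using x unfolding adapted_strategies_def by simp metis
  have g_M[measurable]: "g i \<in> borel_measurable M" for i
    using measurable_from_subalg[OF sub g(1)] .
  have axis_X: "(\<lambda>\<omega>. axis i (h \<omega>)) \<in> X"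
    if h: "h \<in> borel_measurable M" "bounded (range h)" for i and h :: "'w \<Rightarrow> real"
  proof -
    obtain C where "\<And>\<omega>. norm (h \<omega>) \<le> C"
      using h(2) by (auto simp: bounded_iff)
    moreover have "(\<lambda>\<omega>. axis i (h \<omega>)) = (\<lambda>\<omega>. h \<omega> *\<^sub>R axis i (1::real))"
      by (auto simp: fun_eq_iff vec_eq_iff axis_def)
    ultimately have "(\<lambda>\<omega>. axis i (h \<omega>)) \<in> ess_bounded M"
      using h(1) by (auto simp: ess_bounded_def norm_axis_1 intro!: exI[of _ C])
    then show ?thesis
      using ess_bounded_subset[OF X] by blast
  qed
  have pair: "axis i c \<bullet> p \<omega> = c * p \<omega> $ i" for i c \<omega>
    by (simp add: inner_axis')
  \<comment> \<open>The constant unit vectors lie in \<open>X\<close>, and products with elements of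
    \<open>X\<close> are integrable by duality.\<close>
  have p_int: "integrable M (\<lambda>\<omega>. p \<omega> $ i)" for i
  proof -
    have "(\<lambda>_. axis i 1) \<in> X"
      using axis_X[of "\<lambda>_. 1"] by simp
    moreover have "integrable M (\<lambda>\<omega>. z \<omega> \<bullet> p \<omega>)" if "z \<in> X" for z
      using dual pV that by (simp add: separating_duality_def)
    ultimately have "integrable M (\<lambda>\<omega>. axis i 1 \<bullet> p \<omega>)"
      by blast
    then show ?thesis
      by (simp add: pair)
  qed
  have [measurable]: "(\<lambda>\<omega>. p \<omega> $ i) \<in> borel_measurable M" for i
    using p_int by (rule borel_measurable_integrable)
  have p_orth: "(\<integral>\<omega>. h \<omega> * p \<omega> $ i \<partial>M) = 0"
    if h: "h \<in> borel_measurable (F (stage i))" "bounded (range h)" for i and h :: "'w \<Rightarrow> real"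
  proof -
    have h_M: "h \<in> borel_measurable M"
      using measurable_from_subalg[OF sub h(1)] .
    have aX: "(\<lambda>\<omega>. axis i (h \<omega>)) \<in> X"
      using axis_X[OF h_M h(2)] .
    have "\<exists>g \<in> borel_measurable (F (stage j)). AE \<omega> in M. axis i (h \<omega>) $ j = g \<omega>" for j
    proof (cases "j = i")
      case True
      then show ?thesis
        using h(1) by (auto intro!: bexI[of _ h])
    next
      case False
      then show ?thesis
        by (auto simp: axis_def intro!: bexI[of _ "\<lambda>_. 0"])
    qed
    moreover have "(\<lambda>\<omega>. axis i (h \<omega>)) \<in> borel_measurable M"
      using aX X(1) by (auto simp: rv_space_def)
    ultimately have "(\<lambda>\<omega>. axis i (h \<omega>)) \<in> adapted_strategies M F stage"
      by (simp add: adapted_strategies_def)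
    then have "pairing M (\<lambda>\<omega>. axis i (h \<omega>)) p = 0"
      using aX p by (simp add: orth_complement_def)
    then show ?thesis
      by (simp add: pairing_def pair)
  qed
  have eq: "AE \<omega> in M. x \<omega> \<bullet> p \<omega> = (\<Sum>i\<in>UNIV. g i \<omega> * p \<omega> $ i)"
  proof -
    have "AE \<omega> in M. \<forall>i\<in>UNIV. x \<omega> $ i = g i \<omega>"
      using g(2) by (intro AE_finite_allI) auto
    then show ?thesis
      by eventually_elim (simp add: inner_vec_def)
  qed
  have "integrable M (\<lambda>\<omega>. \<Sum>i\<in>UNIV. g i \<omega> * p \<omega> $ i) \<and>
      (\<integral>\<omega>. (\<Sum>i\<in>UNIV. g i \<omega> * p \<omega> $ i) \<partial>M) = 0"
  proof (rule adapted_orthogonal[where G = "\<lambda>i. F (stage i)" and r = stage])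
    show "sets (F (stage i)) \<subseteq> sets (F (stage j))" if "stage i \<le> stage j" for i j
      using F stage that by (simp add: discrete_filtration_def)
    have "integrable M (\<lambda>\<omega>. max 0 (x \<omega> \<bullet> p \<omega>)) \<longleftrightarrow>
        integrable M (\<lambda>\<omega>. max 0 (\<Sum>i\<in>UNIV. g i \<omega> * p \<omega> $ i))"
      by (rule integrable_cong_AE) (measurable, use eq in eventually_elim, simp)
    with pos show "integrable M (\<lambda>\<omega>. max 0 (\<Sum>i\<in>UNIV. g i \<omega> * p \<omega> $ i))"
      by simp
  qed (use sub g p_int p_orth in auto)
  moreover have "integrable M (\<lambda>\<omega>. x \<omega> \<bullet> p \<omega>) \<longleftrightarrow>
      integrable M (\<lambda>\<omega>. \<Sum>i\<in>UNIV. g i \<omega> * p \<omega> $ i)"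
    by (rule integrable_cong_AE) (measurable, rule eq)
  moreover have "pairing M x p = (\<integral>\<omega>. (\<Sum>i\<in>UNIV. g i \<omega> * p \<omega> $ i) \<partial>M)"
    unfolding pairing_def by (rule integral_cong_AE) (measurable, rule eq)
  ultimately show ?thesis
    by simp
qed

section \<open>Weak duality and the optimality conditions\<close>

theorem theorem26:
  fixes M :: "'w measure"
    and T :: nat
    and F :: "nat \<Rightarrow> 'w measure"
    and stage :: "'n::finite \<Rightarrow> nat"
    and f :: "(real ^ 'n) \<times> (real ^ 'm::finite) \<Rightarrow> 'w \<Rightarrow> ereal"
    and X V :: "('w \<Rightarrow> real ^ 'n) set"
    and U Y :: "('w \<Rightarrow> real ^ 'm) set"
    and ubar :: "'w \<Rightarrow> real ^ 'm"
    and N Xa_perp :: "('w \<Rightarrow> real ^ 'n) set"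
    and x p :: "'w \<Rightarrow> real ^ 'n"
    and y :: "'w \<Rightarrow> real ^ 'm"
  defines "N \<equiv> adapted_strategies M F stage"
    and "Xa_perp \<equiv> orth_complement M V (X \<inter> N)"
  assumes "prob_space M"
    and "discrete_filtration M T F"
    and "\<forall>i. stage i \<le> T"
    and "convex_normal_integrand M f"
    and "rv_space M X" "solid M X" "decomposable M X"
    and "rv_space M V" "solid M V" "decomposable M V"
    and "rv_space M U" "solid M U" "decomposable M U"
    and "rv_space M Y" "solid M Y" "decomposable M Y"
    and "separating_duality M X V"
    and "separating_duality M U Y"
    and "ubar \<in> U"
    and "\<exists>x\<in>X. \<exists>u\<in>U. integral_functional M f x u < \<infinity>"
    and "\<exists>x. SP_feasible M f N ubar x"
    and "\<exists>p y. D_feasible M f Xa_perp Y p y"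
  defines "cond1 \<equiv>
        SP_solves M f N ubar x \<and> D_solves M f Xa_perp Y ubar p y \<and>
        SP_value M f N ubar = D_value M f Xa_perp Y ubar"
    and "cond2 \<equiv>
        SP_feasible M f N ubar x \<and> D_feasible M f Xa_perp Y p y \<and>
        (AE \<omega> in M. (p \<omega>, y \<omega>) \<in> subdifferential (\<lambda>z. f z \<omega>) (x \<omega>, ubar \<omega>))"
    and "cond3 \<equiv>
        SP_feasible M f N ubar x \<and> D_feasible M f Xa_perp Y p y \<and>
        (AE \<omega> in M.
           p \<omega> \<in> subdifferential (\<lambda>x'. lagrangian f x' (y \<omega>) \<omega>) (x \<omega>) \<and>
           ubar \<omega> \<in> subdifferential (\<lambda>y'. - lagrangian f (x \<omega>) y' \<omega>) (y \<omega>))"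
  shows "(cond1 \<longleftrightarrow> cond2) \<and> (cond2 \<longleftrightarrow> cond3)"
proof -
  \<comment> \<open>Proved for all feasible points, since weak duality compares every primal point
    with every dual point.\<close>
  have gap: thesis
    if "SP_feasible M f N ubar x" "D_feasible M f Xa_perp Y p y"
      and "\<And>a b. integral_functional M f x ubar = ereal a \<Longrightarrow>
        D_objective M f ubar p y = ereal b \<Longrightarrow> b \<le> a \<Longrightarrow>
        a = b \<longleftrightarrow> (AE \<omega> in M. (p \<omega>, y \<omega>) \<in> subdifferential (\<lambda>z. f z \<omega>) (x \<omega>, ubar \<omega>)) \<Longrightarrow>
        thesis" for x p y thesis
  proof -
    have x: "x \<in> N" and Ef: "integral_functional M f x ubar < \<infinity>"
      using that(1) by (auto simp: SP_feasible_def)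
    have p: "p \<in> Xa_perp" and y: "y \<in> Y"
      and Ec: "integral_functional M (conjugate f) p y < \<infinity>"
      using that(2) by (auto simp: D_feasible_def)
    have meas: "x \<in> borel_measurable M" "ubar \<in> borel_measurable M" "p \<in> borel_measurable M"
        "y \<in> borel_measurable M"
      using x p y assms(10,13,16,21)
      by (auto simp: N_def Xa_perp_def adapted_strategies_def orth_complement_def rv_space_def)
    have uy: "integrable M (\<lambda>\<omega>. ubar \<omega> \<bullet> y \<omega>)"
      using assms(20,21) y by (simp add: separating_duality_def)
    have xp: "integrable M (\<lambda>\<omega>. x \<omega> \<bullet> p \<omega>) \<and> pairing M x p = 0"
      if "integrable M (\<lambda>\<omega>. max 0 (x \<omega> \<bullet> p \<omega>))"
      using assms(4,5,7-10,19) x p that unfolding N_def Xa_perp_def by (rule adapted_pairing_eq_0)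
    obtain a b where ab: "integral_functional M f x ubar = ereal a"
        "integral_functional M (conjugate f) p y = ereal b" "pairing M ubar y \<le> a + b"
        "a + b = pairing M ubar y \<longleftrightarrow>
          (AE \<omega> in M. (p \<omega>, y \<omega>) \<in> subdifferential (\<lambda>z. f z \<omega>) (x \<omega>, ubar \<omega>))"
      using integral_functional_duality_gap[OF assms(6) meas Ef Ec uy xp] by blast
    show thesis
    proof (rule that(3)[OF ab(1)])
      show "D_objective M f ubar p y = ereal (pairing M ubar y - b)"
        using ab(2) by (simp add: D_objective_def)
      show "pairing M ubar y - b \<le> a"
        using ab(3) by simp
      show "a = pairing M ubar y - b \<longleftrightarrow>
          (AE \<omega> in M. (p \<omega>, y \<omega>) \<in> subdifferential (\<lambda>z. f z \<omega>) (x \<omega>, ubar \<omega>))"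
        using ab(4) by (simp add: eq_diff_eq)
    qed
  qed
  \<comment> \<open>At an infeasible point the primal objective is \<infinity> or the dual one is
    -\<infinity>, so only feasible pairs need the gap estimate.\<close>
  have weak: "D_value M f Xa_perp Y ubar \<le> SP_value M f N ubar"
    unfolding D_value_def SP_value_def
  proof (safe intro!: SUP_least INF_greatest)
    fix p y x assume "p \<in> Xa_perp" "y \<in> Y" "x \<in> N"
    then consider "integral_functional M f x ubar = \<infinity>"
      | "integral_functional M (conjugate f) p y = \<infinity>"
      | "SP_feasible M f N ubar x" "D_feasible M f Xa_perp Y p y"
      by (auto simp: SP_feasible_def D_feasible_def)
    then show "D_objective M f ubar p y \<le> integral_functional M f x ubar"
    proof cases
      case 3
      then show ?thesis
        by (rule gap) simp
    qed (auto simp: D_objective_def)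
  qed
  have "cond1 \<longleftrightarrow> cond2"
  proof (cases "SP_feasible M f N ubar x \<and> D_feasible M f Xa_perp Y p y")
    case True
    then have "SP_feasible M f N ubar x" "D_feasible M f Xa_perp Y p y"
      by blast+
    then obtain a b where ab: "integral_functional M f x ubar = ereal a"
        "D_objective M f ubar p y = ereal b" "b \<le> a"
        "a = b \<longleftrightarrow> (AE \<omega> in M. (p \<omega>, y \<omega>) \<in> subdifferential (\<lambda>z. f z \<omega>) (x \<omega>, ubar \<omega>))"
      by (rule gap)
    have SP: "SP_value M f N ubar \<le> ereal a"
      unfolding SP_value_def ab(1)[symmetric] using True
      by (intro INF_lower) (simp add: SP_feasible_def)
    have D: "ereal b \<le> D_value M f Xa_perp Y ubar"
      unfolding D_value_def ab(2)[symmetric] using True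
      by (intro SUP_upper2[of "(p, y)"]) (auto simp: D_feasible_def)
    \<comment> \<open>The chain \<open>b \<le> D_value \<le> SP_value \<le> a\<close> collapses as
      soon as \<open>a = b\<close>.\<close>
    have "ereal a = SP_value M f N ubar \<and> ereal b = D_value M f Xa_perp Y ubar \<and>
        SP_value M f N ubar = D_value M f Xa_perp Y ubar \<longleftrightarrow> a = b" (is "?opt \<longleftrightarrow> _")
    proof
      assume ?opt
      then have "ereal a = ereal b"
        by simp
      then show "a = b"
        by simp
    next
      assume "a = b"
      then have "ereal a \<le> D_value M f Xa_perp Y ubar"
        using D by simp
      then have "SP_value M f N ubar = D_value M f Xa_perp Y ubar" "ereal a = SP_value M f N ubar"
        using SP weak by order+
      with \<open>a = b\<close> show ?opt
        by simp
    qed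
    then show ?thesis
      unfolding cond1_def cond2_def SP_solves_def D_solves_def using True ab by auto
  qed (auto simp: cond1_def cond2_def SP_solves_def D_solves_def)
  \<comment> \<open>Primal feasibility makes \<open>f (x, ubar)\<close> smaller than \<infinity>
    almost surely, which the pointwise Lagrangian equivalence requires.\<close>
  moreover have "cond2 \<longleftrightarrow> cond3"
  proof (cases "SP_feasible M f N ubar x")
    case True
    then have "integral_functional M f x ubar < \<infinity>" "x \<in> borel_measurable M"
      by (auto simp: SP_feasible_def N_def adapted_strategies_def)
    moreover have "ubar \<in> borel_measurable M"
      using assms(13,21) by (auto simp: rv_space_def)
    ultimately have "AE \<omega> in M. f (x \<omega>, ubar \<omega>) \<omega> < \<infinity>"
      unfolding integral_functional_def
      by (intro ext_expectation_less_top(1) normal_integrand_measurable[OF assms(6)] borel_measurable_Pair)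
    then have "AE \<omega> in M. (p \<omega>, y \<omega>) \<in> subdifferential (\<lambda>z. f z \<omega>) (x \<omega>, ubar \<omega>) \<longleftrightarrow>
        p \<omega> \<in> subdifferential (\<lambda>x'. lagrangian f x' (y \<omega>) \<omega>) (x \<omega>) \<and>
        ubar \<omega> \<in> subdifferential (\<lambda>y'. - lagrangian f (x \<omega>) y' \<omega>) (y \<omega>)"
      \<comment> \<open>Convexity and closedness of the integrand are given only for \<omega> in
        \<open>space M\<close>.\<close>
      using AE_space
      by eventually_elim
        (use assms(6) in \<open>simp add: mem_subdifferential_iff_lagrangian convex_normal_integrand_def\<close>)
    from eventually_subst[OF this] show ?thesis
      by (simp add: cond2_def cond3_def)
  qed (simp add: cond2_def cond3_def)
  ultimately show ?thesis
    by blast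
qed

end
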